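(* Let $n\ge 1$, $y\in\mathbb{R}^n$ and $z\in\mathbb{R}^n_{\ge 0}$ with $\mathrm{sum}(z)\neq 0$. Then the real $n\times n$ matrix $$\mathrm{diag}(y\odot z\odot y) - (y\odot z)(y\odot z)^\top/\mathrm{sum}(z)$$ is positive semidefinite.
   Context: $\mathbb{R}^n_{\ge 0}$ is the set of vectors in $\mathbb{R}^n$ with all entries non-negative; $\odot$ is the elementwise product of vectors; $\mathrm{diag}(v)$ is the diagonal matrix with diagonal $v$; $\mathrm{sum}(z)=\sum_{i=1}^n z_i$; vectors are column vectors, so $(y\odot z)(y\odot z)^\top$ is an $n\times n$ matrix. A symmetric matrix $A$ is positive semidefinite if $v^\top A v\ge 0$ for all $v\in\mathbb{R}^n$. *)

theory Defs
  imports "HOL-Analysis.Analysis"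
begin

definition diag_mat :: "real ^ 'n \<Rightarrow> real ^ 'n ^ 'n" where
  "diag_mat v = (\<chi> i j. if i = j then v $ i else 0)"

(* Symmetry is part of the notion: positive semidefiniteness is a property of symmetric matrices. *)
definition positive_semidefinite :: "real ^ 'n ^ 'n \<Rightarrow> bool" where
  "positive_semidefinite A \<longleftrightarrow> transpose A = A \<and> (\<forall>v. v \<bullet> (A *v v) \<ge> 0)"

(* The column vector v as an n x 1 matrix, so that v v^T is an ordinary matrix product. *)
definition outer_self :: "real ^ 'n \<Rightarrow> real ^ 'n ^ 'n" where
  "outer_self v = (columnvector v :: real ^ 1 ^ 'n) ** transpose (columnvector v)"

end

theory Submission
  imports Defs
begin

text \<open>
  The quadratic form of the matrix at \<open>v\<close> is, with \<open>w = y * v\<close> componentwise,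
  \<open>(\<Sum>i. z\<^sub>i w\<^sub>i\<^sup>2) - (\<Sum>i. z\<^sub>i w\<^sub>i)\<^sup>2 / (\<Sum>i. z\<^sub>i)\<close>. Up to the factor \<open>\<Sum>i. z\<^sub>i\<close>, this is the
  variance of \<open>w\<close> under the probability weights \<open>z\<^sub>i / (\<Sum>j. z\<^sub>j)\<close>, so it is nonnegative. The
  inequality behind this is the weighted Cauchy-Schwarz inequality
  \<open>weighted_sum_squared_le\<close>; the lemmas \<open>inner_diag_mat\<close> and \<open>inner_outer_self\<close> produce the two
  terms of the form.
\<close>

text \<open>The Cauchy-Schwarz inequality for the vectors \<open>\<surd>z\<^sub>i\<close> and \<open>\<surd>z\<^sub>i w\<^sub>i\<close>.\<close>

lemma weighted_sum_squared_le:
  fixes z w :: "'a \<Rightarrow> real"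
  assumes "\<And>i. i \<in> I \<Longrightarrow> z i \<ge> 0"
  shows "(\<Sum>i\<in>I. z i * w i)\<^sup>2 \<le> (\<Sum>i\<in>I. z i) * (\<Sum>i\<in>I. z i * (w i)\<^sup>2)"
proof -
  have "(\<Sum>i\<in>I. z i * w i) = (\<Sum>i\<in>I. sqrt (z i) * (sqrt (z i) * w i))"
    using assms by (intro sum.cong) (simp_all flip: mult.assoc)
  moreover have "(\<Sum>i\<in>I. (sqrt (z i))\<^sup>2) = (\<Sum>i\<in>I. z i)"
    using assms by (intro sum.cong) simp_all
  moreover have "(\<Sum>i\<in>I. (sqrt (z i) * w i)\<^sup>2) = (\<Sum>i\<in>I. z i * (w i)\<^sup>2)"
    using assms by (intro sum.cong) (simp_all add: power_mult_distrib)
  ultimately show ?thesis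
    using Cauchy_Schwarz_ineq_sum[of "\<lambda>i. sqrt (z i)" "\<lambda>i. sqrt (z i) * w i" I] by simp
qed

lemma outer_self_nth: "outer_self u $ i $ j = u $ i * u $ j"
  by (simp add: outer_self_def matrix_matrix_mult_def transpose_def columnvector_def)

lemma inner_diag_mat: "v \<bullet> (diag_mat d *v v) = (\<Sum>i\<in>UNIV. d $ i * (v $ i)\<^sup>2)"
proof -
  have "(diag_mat d *v v) $ i = d $ i * v $ i" for i
    by (simp add: diag_mat_def matrix_vector_mult_def if_distrib[of "\<lambda>x. x * _"] cong: if_cong)
  then show ?thesis
    by (simp add: inner_vec_def power2_eq_square algebra_simps)
qed

lemma inner_outer_self: "v \<bullet> (outer_self u *v v) = (u \<bullet> v)\<^sup>2"
proof -
  have "outer_self u *v v = (u \<bullet> v) *\<^sub>R u"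
    by (simp add: vec_eq_iff matrix_vector_mult_def outer_self_nth inner_vec_def
        sum_distrib_left mult_ac)
  then show ?thesis
    by (simp add: inner_commute power2_eq_square)
qed

theorem proposition2:
  fixes y z :: "real ^ 'n"
  assumes z_nonneg: "\<forall>i. z $ i \<ge> 0"
    and sum_z: "(\<Sum>i\<in>UNIV. z $ i) \<noteq> 0"
  shows "positive_semidefinite
    (diag_mat (y * z * y) - outer_self (y * z) /\<^sub>R (\<Sum>i\<in>UNIV. z $ i))"
proof -
  define S where "S = (\<Sum>i\<in>UNIV. z $ i)"
  let ?A = "diag_mat (y * z * y) - outer_self (y * z) /\<^sub>R S"
  have S_pos: "S > 0"
    using z_nonneg sum_z by (simp add: S_def sum_nonneg less_le)
  have "transpose ?A = ?A"
    by (simp add: vec_eq_iff transpose_def diag_mat_def outer_self_nth mult.commute)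
  moreover have "v \<bullet> (?A *v v) \<ge> 0" for v
  proof -
    let ?w = "\<lambda>i. y $ i * v $ i"
    have diag: "v \<bullet> (diag_mat (y * z * y) *v v) = (\<Sum>i\<in>UNIV. z $ i * (?w i)\<^sup>2)"
      by (simp add: inner_diag_mat power2_eq_square mult_ac)
    have outer: "v \<bullet> (outer_self (y * z) *v v) = (\<Sum>i\<in>UNIV. z $ i * ?w i)\<^sup>2"
      unfolding inner_outer_self by (simp add: inner_vec_def mult_ac)
    have "v \<bullet> (?A *v v) = (\<Sum>i\<in>UNIV. z $ i * (?w i)\<^sup>2) - (\<Sum>i\<in>UNIV. z $ i * ?w i)\<^sup>2 / S"
      by (simp add: matrix_vector_mult_diff_rdistrib scaleR_matrix_vector_assoc[symmetric]
          inner_diff_right diag outer divide_inverse_commute)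
    moreover have "(\<Sum>i\<in>UNIV. z $ i * ?w i)\<^sup>2 \<le> S * (\<Sum>i\<in>UNIV. z $ i * (?w i)\<^sup>2)"
      unfolding S_def using z_nonneg by (intro weighted_sum_squared_le) simp
    ultimately show ?thesis
      using S_pos by (simp add: pos_divide_le_eq mult.commute)
  qed
  ultimately show ?thesis
    by (simp add: positive_semidefinite_def S_def)
qed

end
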